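(* Let $M$ be a connected $m$-dimensional topological manifold without boundary, where $m\geq 2$. For $k>r\geq 1$, the projection $\pi_{k,r}^M:F(M,k)\to F(M,r)$ has Nielsen root number $NR(\pi_{k,r}^M,a)\leq 1$ for any $a\in F(M,r)$.
   Context: The ordered configuration space is $F(M,k)=\{(x_1,\ldots,x_k)\in M^k : x_i\neq x_j \text{ whenever } i\neq j\}$ with the subspace topology from $M^k$, and $\pi_{k,r}^M(x_1,\ldots,x_r,\ldots,x_k)=(x_1,\ldots,x_r)$. Nielsen root number: let $f:X\to Y$ be a continuous map between path-connected spaces and $a\in Y$. A root of $f$ at $a$ is a point $x\in X$ with $f(x)=a$. Two roots $x_0,x_1\in f^{-1}(a)$ are equivalent if there is a path $\alpha:[0,1]\to X$ from $x_0$ to $x_1$ such that the loop $f\circ\alpha$ represents the trivial element of $\pi_1(Y,a)$; this is an equivalence relation, whose classes are called root classes. Given a homotopy $H:X\times[0,1]\to Y$, with $H_t=H(\cdot,t)$, a root $x_0\in H_0^{-1}(a)$ is $H$-related to a root $x_1\in H_1^{-1}(a)$ if there is a path $\alpha:[0,1]\to X$ from $x_0$ to $x_1$ such that the loop $t\mapsto H(\alpha(t),t)$ represents the trivial element of $\pi_1(Y,a)$. A root $x_0\in f^{-1}(a)$ is essential if for every homotopy $H:X\times[0,1]\to Y$ with $H_0=f$ there is a root $x_1\in H_1^{-1}(a)$ to which $x_0$ is $H$-related. If one root in a root class is essential then so are all others in the class, and the class is called essential. $NR(f,a)$ is the number of essential root classes of $f$ at $a$. *)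

theory Defs
  imports "HOL-Analysis.Analysis" "HOL-Library.Extended_Nat"
begin

text \<open>
  Manifolds without boundary: every point has a neighbourhood homeomorphic to an open subset of
  \<open>m\<close>-dimensional Euclidean space (not of a half-space).
\<close>

definition topological_manifold :: "nat \<Rightarrow> 'a topology \<Rightarrow> bool" where
  "topological_manifold m M \<longleftrightarrow>
     Hausdorff_space M \<and> second_countable M \<and>
     (\<forall>x \<in> topspace M. \<exists>U V. openin M U \<and> x \<in> U \<and> openin (Euclidean_space m) V \<and>
        subtopology M U homeomorphic_space subtopology (Euclidean_space m) V)"

text \<open>
  Points of \<open>M\<^sup>k\<close> are the functions on \<open>{1..k}\<close> that are \<^const>\<open>undefined\<close> elsewhere, as required by
  \<^const>\<open>product_topology\<close>; hence the projection has to be \<^const>\<open>restrict\<close>.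
\<close>

definition config_space :: "'a topology \<Rightarrow> nat \<Rightarrow> (nat \<Rightarrow> 'a) topology" where
  "config_space M k =
     subtopology (product_topology (\<lambda>_. M) {1..k})
       {x. \<forall>i \<in> {1..k}. \<forall>j \<in> {1..k}. i \<noteq> j \<longrightarrow> x i \<noteq> x j}"

definition config_proj :: "nat \<Rightarrow> (nat \<Rightarrow> 'a) \<Rightarrow> nat \<Rightarrow> 'a" where
  "config_proj r x = restrict x {1..r}"

definition roots :: "'a topology \<Rightarrow> ('a \<Rightarrow> 'b) \<Rightarrow> 'b \<Rightarrow> 'a set" where
  "roots X f a = {x \<in> topspace X. f x = a}"

text \<open>
  The homotopy is relative to the endpoints, as for \<^const>\<open>homotopic_paths\<close>, which is only
  available for subsets of a topological space type.
\<close>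

definition trivial_loop :: "'b topology \<Rightarrow> 'b \<Rightarrow> (real \<Rightarrow> 'b) \<Rightarrow> bool" where
  "trivial_loop Y a p \<longleftrightarrow>
     homotopic_with (\<lambda>q. q 0 = a \<and> q 1 = a) (top_of_set {0..1}) Y p (\<lambda>_. a)"

definition root_equiv ::
  "'a topology \<Rightarrow> 'b topology \<Rightarrow> ('a \<Rightarrow> 'b) \<Rightarrow> 'b \<Rightarrow> ('a \<times> 'a) set" where
  "root_equiv X Y f a =
     {(x0, x1). x0 \<in> roots X f a \<and> x1 \<in> roots X f a \<and>
        (\<exists>\<alpha>. pathin X \<alpha> \<and> \<alpha> 0 = x0 \<and> \<alpha> 1 = x1 \<and> trivial_loop Y a (f \<circ> \<alpha>))}"

definition root_classes ::
  "'a topology \<Rightarrow> 'b topology \<Rightarrow> ('a \<Rightarrow> 'b) \<Rightarrow> 'b \<Rightarrow> 'a set set" where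
  "root_classes X Y f a = roots X f a // root_equiv X Y f a"

definition homotopy_related ::
  "'a topology \<Rightarrow> 'b topology \<Rightarrow> ('a \<times> real \<Rightarrow> 'b) \<Rightarrow> 'b \<Rightarrow> 'a \<Rightarrow> 'a \<Rightarrow> bool" where
  "homotopy_related X Y H a x0 x1 \<longleftrightarrow>
     (\<exists>\<alpha>. pathin X \<alpha> \<and> \<alpha> 0 = x0 \<and> \<alpha> 1 = x1 \<and> trivial_loop Y a (\<lambda>t. H (\<alpha> t, t)))"

definition essential_root ::
  "'a topology \<Rightarrow> 'b topology \<Rightarrow> ('a \<Rightarrow> 'b) \<Rightarrow> 'b \<Rightarrow> 'a \<Rightarrow> bool" where
  "essential_root X Y f a x0 \<longleftrightarrow>
     x0 \<in> roots X f a \<and>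
     (\<forall>H. continuous_map (prod_topology X (top_of_set {0..1})) Y H \<and>
          (\<forall>x \<in> topspace X. H (x, 0) = f x) \<longrightarrow>
          (\<exists>x1 \<in> roots X (\<lambda>x. H (x, 1)) a. homotopy_related X Y H a x0 x1))"

definition essential_root_classes ::
  "'a topology \<Rightarrow> 'b topology \<Rightarrow> ('a \<Rightarrow> 'b) \<Rightarrow> 'b \<Rightarrow> 'a set set" where
  "essential_root_classes X Y f a =
     {C \<in> root_classes X Y f a. \<exists>x \<in> C. essential_root X Y f a x}"

text \<open>
  Valued in \<^typ>\<open>enat\<close> because \<^const>\<open>card\<close> is \<open>0\<close> on infinite sets.
\<close>

definition nielsen_root_number ::
  "'a topology \<Rightarrow> 'b topology \<Rightarrow> ('a \<Rightarrow> 'b) \<Rightarrow> 'b \<Rightarrow> enat" where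
  "nielsen_root_number X Y f a =
     (if finite (essential_root_classes X Y f a)
      then enat (card (essential_root_classes X Y f a)) else \<infinity>)"

end

theory Submission
  imports Defs
begin

text \<open>
  All roots of \<open>\<pi>\<^sub>k\<^sub>,\<^sub>r\<close> at \<open>a\<close> are equivalent, so there is at most one root class at all, essential or
  not. The set of roots is the fibre over \<open>a\<close>, that is, the configurations whose first \<open>r\<close> points
  are \<open>a 1, \<dots>, a r\<close> and whose other \<open>k - r\<close> points are free. A path inside the fibre projects to
  the constant loop at \<open>a\<close>, so it is enough that the fibre is path connected
  (\<open>path_component_of_same_projection\<close>).

  To join two configurations \<open>x\<close> and \<open>y\<close> of the fibre, choose \<open>k - r\<close> distinct points of \<open>M\<close> that
  occur neither in \<open>x\<close> nor in \<open>y\<close>, and move the free points of \<open>x\<close>, and likewise those of \<open>y\<close>, to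
  these new places one after the other. As the targets are unoccupied, the moves do not obstruct
  each other. Each single move needs only that \<open>M\<close> stays path connected when the finitely many
  other points of the configuration are removed (\<open>path_connectedin_minus_finite\<close>).

  This is where \<open>m \<ge> 2\<close> enters. An open box in \<open>\<real>\<^sup>m\<close> minus its centre is then connected
  (\<open>connectedin_open_box_minus_centre\<close>), and charts carry such boxes to \<open>M\<close>. Removing a point from
  a connected space cannot disconnect it if the point has an open neighbourhood that stays connected
  without it (\<open>connected_space_delete_point\<close>); induction deals with finitely many points, and local
  path connectedness turns connected into path connected.
\<close>

section \<open>Neighbourhoods that stay connected without their centre\<close>

text \<open>
  What the charts of a manifold of dimension at least 2 contribute to the proof. In this form, the
  property is visibly local and inherited by open subsets, as the induction over the removed
  points requires. Since the empty set counts as connected, \<open>W \<noteq> {x}\<close> has to be demanded to rule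
  out isolated points.
\<close>

definition punctured_connected_base :: "'a topology \<Rightarrow> bool" where
  "punctured_connected_base X \<longleftrightarrow>
     (\<forall>N x. openin X N \<and> x \<in> N \<longrightarrow>
        (\<exists>W. openin X W \<and> x \<in> W \<and> W \<subseteq> N \<and> path_connectedin X W \<and>
             connectedin X (W - {x}) \<and> W \<noteq> {x}))"

text \<open>
  The points of the box with \<open>i\<close>-th coordinate above that of the centre form a smaller box, hence a
  connected set, and for varying \<open>i\<close> these upper halves share the point \<open>p\<close>; likewise the lower
  halves share \<open>q\<close>. All halves together cover the box minus its centre. With two coordinates
  available, some upper half meets some lower half, here in the point \<open>z\<close>.
\<close>

lemma connectedin_open_box_minus_centre:
  fixes e x :: "nat \<Rightarrow> real"
  assumes m: "m \<ge> 2" and e: "\<And>i. i < m \<Longrightarrow> e i > 0" and x: "x \<in> extensional {..<m}"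
  defines "W \<equiv> PiE {..<m} (\<lambda>i. {x i - e i<..<x i + e i})"
  shows "connectedin (product_topology (\<lambda>_. euclideanreal) {..<m}) (W - {x})" and "W \<noteq> {x}"
proof -
  let ?P = "product_topology (\<lambda>_. euclideanreal) {..<m}"
  define upper where
    "upper i = PiE {..<m} (\<lambda>j. if j = i then {x j<..<x j + e j} else {x j - e j<..<x j + e j})" for i
  define lower where
    "lower i = PiE {..<m} (\<lambda>j. if j = i then {x j - e j<..<x j} else {x j - e j<..<x j + e j})" for i
  define p where "p = restrict (\<lambda>j. x j + e j / 2) {..<m}"
  define q where "q = restrict (\<lambda>j. x j - e j / 2) {..<m}"
  define z where "z = restrict (\<lambda>j. if j = 0 then x j + e j / 2 else x j - e j / 2) {..<m}"
  have conn: "connectedin ?P (upper i)" "connectedin ?P (lower i)" for i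
    unfolding upper_def lower_def connectedin_PiE by auto
  have p: "p \<in> upper i" and q: "q \<in> lower i" for i
    using e by (auto simp: p_def q_def upper_def lower_def field_simps)
  have z: "z \<in> upper 0" "z \<in> lower 1"
    using e m by (auto simp: z_def upper_def lower_def field_simps)
  have "p \<in> \<Inter> (upper ` {..<m})" "q \<in> \<Inter> (lower ` {..<m})"
    using p q by blast+
  then have "connectedin ?P (\<Union>i<m. upper i)" "connectedin ?P (\<Union>i<m. lower i)"
    using conn connectedin_Union[of "upper ` {..<m}" ?P] connectedin_Union[of "lower ` {..<m}" ?P]
    by blast+
  moreover have "z \<in> (\<Union>i<m. upper i) \<inter> (\<Union>i<m. lower i)"
  proof
    show "z \<in> (\<Union>i<m. upper i)" using z(1) m by (intro UN_I[of 0]) auto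
    show "z \<in> (\<Union>i<m. lower i)" using z(2) m by (intro UN_I[of 1]) auto
  qed
  ultimately have "connectedin ?P ((\<Union>i<m. upper i) \<union> (\<Union>i<m. lower i))"
    by (intro connectedin_Un) auto
  also have "(\<Union>i<m. upper i) \<union> (\<Union>i<m. lower i) = W - {x}"
  proof (intro equalityI subsetI)
    fix y assume "y \<in> (\<Union>i<m. upper i) \<union> (\<Union>i<m. lower i)"
    then obtain i where i: "i < m" "y \<in> upper i \<or> y \<in> lower i" by blast
    have "y \<in> W"
    proof -
      have "upper i \<subseteq> W" "lower i \<subseteq> W"
        unfolding upper_def lower_def W_def using e[OF i(1)] by (intro PiE_mono; auto)+
      with i show ?thesis by blast
    qed
    moreover have "y i \<noteq> x i"
      using i by (auto simp: upper_def lower_def dest!: PiE_mem[where x=i])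
    ultimately show "y \<in> W - {x}" by auto
  next
    fix y assume y: "y \<in> W - {x}"
    then have "y \<in> extensional {..<m}" by (auto simp: W_def PiE_def)
    with y x obtain i where i: "i < m" "y i \<noteq> x i"
      by (metis DiffE extensionalityI lessThan_iff singletonI)
    then have "y \<in> upper i \<or> y \<in> lower i"
      using y by (auto simp: W_def upper_def lower_def PiE_iff)
    with i show "y \<in> (\<Union>i<m. upper i) \<union> (\<Union>i<m. lower i)" by blast
  qed
  finally show "connectedin ?P (W - {x})" .
  have "p \<in> W" using e by (auto simp: p_def W_def field_simps)
  moreover have "p 0 \<noteq> x 0" using e[of 0] m by (simp add: p_def)
  ultimately show "W \<noteq> {x}" by auto
qed

lemma punctured_connected_base_product_real:
  assumes "m \<ge> 2"
  shows "punctured_connected_base (product_topology (\<lambda>_. euclideanreal) {..<m::nat})"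
  unfolding punctured_connected_base_def
proof (intro allI impI)
  let ?P = "product_topology (\<lambda>_. euclideanreal) {..<m}"
  fix N and x :: "nat \<Rightarrow> real" assume N: "openin ?P N \<and> x \<in> N"
  then have "\<exists>U. (\<forall>i\<in>{..<m}. openin euclideanreal (U i)) \<and> x \<in> PiE {..<m} U \<and> PiE {..<m} U \<subseteq> N"
    unfolding openin_product_topology_alt by blast
  then obtain U where U: "\<And>i. i < m \<Longrightarrow> open (U i)" "x \<in> PiE {..<m} U" "PiE {..<m} U \<subseteq> N"
    by (metis lessThan_iff open_openin)
  have "\<forall>i. \<exists>e. i < m \<longrightarrow> e > 0 \<and> ball (x i) e \<subseteq> U i"
  proof
    fix i show "\<exists>e. i < m \<longrightarrow> e > 0 \<and> ball (x i) e \<subseteq> U i"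
    proof (cases "i < m")
      case True
      then have "open (U i)" "x i \<in> U i" using U by (auto simp: PiE_iff)
      then show ?thesis using open_contains_ball by blast
    qed simp
  qed
  then obtain e where e: "\<And>i. i < m \<Longrightarrow> e i > 0 \<and> ball (x i) (e i) \<subseteq> U i" by metis
  have x: "x \<in> extensional {..<m}" using U by (auto simp: PiE_def)
  define W where "W = PiE {..<m} (\<lambda>i. {x i - e i<..<x i + e i})"
  have "openin ?P W" unfolding W_def by (auto simp: openin_PiE_gen)
  moreover have "x \<in> W" using e x by (auto simp: W_def PiE_iff)
  moreover have "W \<subseteq> N"
  proof -
    have "W \<subseteq> PiE {..<m} U" unfolding W_def
      by (rule PiE_mono) (use e in \<open>auto simp: ball_eq_greaterThanLessThan\<close>)
    with U show ?thesis by blast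
  qed
  moreover have "path_connectedin ?P W" unfolding W_def path_connectedin_PiE by (auto simp: is_interval_path_connected)
  moreover have "connectedin ?P (W - {x})" "W \<noteq> {x}"
    using connectedin_open_box_minus_centre[OF assms _ x, of e] e by (simp_all add: W_def)
  ultimately show "\<exists>W. openin ?P W \<and> x \<in> W \<and> W \<subseteq> N \<and> path_connectedin ?P W \<and>
             connectedin ?P (W - {x}) \<and> W \<noteq> {x}"
    by blast
qed

lemma punctured_connected_base_open_subset:
  assumes "punctured_connected_base X" "openin X U"
  shows "punctured_connected_base (subtopology X U)"
  unfolding punctured_connected_base_def
proof (intro allI impI)
  fix N x assume "openin (subtopology X U) N \<and> x \<in> N"
  then have "openin X N" "N \<subseteq> U" "x \<in> N"
    using assms(2) by (auto simp: openin_open_subtopology)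
  then obtain W where "openin X W" "x \<in> W" "W \<subseteq> N" "path_connectedin X W"
             "connectedin X (W - {x})" "W \<noteq> {x}"
    using assms(1) unfolding punctured_connected_base_def by meson
  with \<open>N \<subseteq> U\<close> show "\<exists>W. openin (subtopology X U) W \<and> x \<in> W \<and> W \<subseteq> N \<and>
     path_connectedin (subtopology X U) W \<and> connectedin (subtopology X U) (W - {x}) \<and> W \<noteq> {x}"
    using assms(2) by (intro exI[of _ W])
      (auto simp: openin_open_subtopology path_connectedin_subtopology connectedin_subtopology)
qed

lemma punctured_connected_base_homeomorphic:
  assumes "punctured_connected_base X" "X homeomorphic_space Y"
  shows "punctured_connected_base Y"
  unfolding punctured_connected_base_def
proof (intro allI impI)
  obtain h where h: "homeomorphic_map Y X h"
    using assms(2) homeomorphic_space homeomorphic_space_sym by blast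
  then have inj: "inj_on h (topspace Y)" and surj: "h ` topspace Y = topspace X"
    by (auto simp: homeomorphic_eq_everything_map)
  fix N x assume N: "openin Y N \<and> x \<in> N"
  then have NY: "N \<subseteq> topspace Y" by (simp add: openin_subset)
  then have "openin X (h ` N)" using h N by (simp add: homeomorphic_map_openness)
  then obtain V where V: "openin X V" "h x \<in> V" "V \<subseteq> h ` N" "path_connectedin X V"
             "connectedin X (V - {h x})" "V \<noteq> {h x}"
    using assms(1) N unfolding punctured_connected_base_def by (meson imageI)
  define W where "W = {y \<in> N. h y \<in> V}"
  have hW: "h ` W = V" using V by (auto simp: W_def)
  have WY: "W \<subseteq> topspace Y" using NY by (auto simp: W_def)
  have xW: "x \<in> W" using N V by (simp add: W_def)
  have hWx: "h ` (W - {x}) = V - {h x}"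
    using inj_on_image_set_diff[OF inj, of W "{x}"] WY xW hW by auto
  have "openin Y W"
    using homeomorphic_map_openness[OF h WY] V(1) hW by simp
  moreover have "path_connectedin Y W"
    using homeomorphic_map_path_connectedness[OF h WY] V(4) hW by simp
  moreover have "connectedin Y (W - {x})"
    using homeomorphic_map_connectedness[OF h, of "W - {x}"] WY V(5) hWx by auto
  ultimately show "\<exists>W. openin Y W \<and> x \<in> W \<and> W \<subseteq> N \<and>
     path_connectedin Y W \<and> connectedin Y (W - {x}) \<and> W \<noteq> {x}"
    using xW hW V(6) by (intro exI[of _ W]) (auto simp: W_def)
qed

lemma punctured_connected_base_locally:
  assumes "\<And>x. x \<in> topspace X \<Longrightarrow>
    \<exists>U. openin X U \<and> x \<in> U \<and> punctured_connected_base (subtopology X U)"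
  shows "punctured_connected_base X"
  unfolding punctured_connected_base_def
proof (intro allI impI)
  fix N x assume N: "openin X N \<and> x \<in> N"
  then have "x \<in> topspace X" using openin_subset by blast
  from assms[OF this] obtain U
    where U: "openin X U" "x \<in> U" "punctured_connected_base (subtopology X U)"
    by blast
  have "openin (subtopology X U) (U \<inter> N)" "x \<in> U \<inter> N"
    using N U by (auto simp: openin_open_subtopology)
  then obtain W where "openin (subtopology X U) W" "x \<in> W" "W \<subseteq> U \<inter> N"
     "path_connectedin (subtopology X U) W" "connectedin (subtopology X U) (W - {x})" "W \<noteq> {x}"
    using U(3) unfolding punctured_connected_base_def by meson
  with U(1) show "\<exists>W. openin X W \<and> x \<in> W \<and> W \<subseteq> N \<and>
     path_connectedin X W \<and> connectedin X (W - {x}) \<and> W \<noteq> {x}"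
    by (intro exI[of _ W])
      (auto simp: openin_open_subtopology path_connectedin_subtopology connectedin_subtopology)
qed

lemma punctured_connected_base_manifold:
  assumes "topological_manifold m M" "m \<ge> 2"
  shows "punctured_connected_base M"
proof (rule punctured_connected_base_locally)
  fix x assume "x \<in> topspace M"
  then obtain U V where U: "openin M U" "x \<in> U" and V: "openin (Euclidean_space m) V"
    and UV: "subtopology M U homeomorphic_space subtopology (Euclidean_space m) V"
    using assms(1) unfolding topological_manifold_def by meson
  have "punctured_connected_base (Euclidean_space m)"
    using punctured_connected_base_homeomorphic[OF punctured_connected_base_product_real]
      homeomorphic_Euclidean_space_product_topology homeomorphic_space_sym assms(2) by blast
  then have "punctured_connected_base (subtopology M U)"
    using punctured_connected_base_homeomorphic punctured_connected_base_open_subset V UV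
      homeomorphic_space_sym by blast
  with U show "\<exists>U. openin M U \<and> x \<in> U \<and> punctured_connected_base (subtopology M U)" by blast
qed

section \<open>Removing finitely many points\<close>

text \<open>
  If \<open>A\<close> and \<open>B\<close> separate the space without \<open>p\<close>, then the connected set \<open>W - {p}\<close> lies on one
  side, say in \<open>A\<close>. So \<open>insert p A = A \<union> W\<close> is open, and together with \<open>B\<close> it separates the
  whole space.
\<close>

lemma connected_space_delete_point:
  assumes conn: "connected_space X" and t1: "t1_space X"
    and W: "openin X W" "p \<in> W" "connectedin X (W - {p})"
  shows "connected_space (subtopology X (topspace X - {p}))"
proof -
  have p: "p \<in> topspace X" using W openin_subset by blast
  have op: "openin X (topspace X - {p})"
    using t1 p by (simp add: closedin_t1_singleton openin_diff)
  \<comment> \<open>Stated for one side only, so that it can be used with the roles of \<open>A\<close> and \<open>B\<close> exchanged.\<close>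
  have *: False
    if A: "openin X A" and B: "openin X B" and AB: "A \<union> B = topspace X - {p}" "A \<inter> B = {}"
      "B \<noteq> {}" and WA: "W - {p} \<subseteq> A" for A B
  proof -
    have "A \<union> W = insert p A" using WA W by auto
    then have "openin X (insert p A)" by (metis A W(1) openin_Un)
    moreover have "insert p A \<union> B = topspace X" "insert p A \<inter> B = {}" using AB p by auto
    ultimately show False using conn B AB(3) unfolding connected_space_eq by blast
  qed
  show ?thesis
    unfolding connected_space_eq
  proof clarify
    fix A B
    assume "openin (subtopology X (topspace X - {p})) A" "openin (subtopology X (topspace X - {p})) B"
      and un: "A \<union> B = topspace (subtopology X (topspace X - {p}))"
      and AB: "A \<inter> B = {}" "A \<noteq> {}" "B \<noteq> {}"
    then have A: "openin X A" and B: "openin X B"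
      using op by (auto simp: openin_open_subtopology)
    have un': "A \<union> B = topspace X - {p}" using un by auto
    have "W - {p} \<subseteq> A \<union> B" using un' W openin_subset by blast
    then have "W - {p} \<subseteq> A \<or> W - {p} \<subseteq> B"
      using connectedinD[OF W(3) A B] AB by blast
    then show False
      using *[OF A B] *[OF B A] un' AB by blast
  qed
qed

text \<open>
  Connectedness survives the removal of one point after another because what is left is open and
  therefore inherits the neighbourhood base; path connectedness is only recovered at the end, from
  connectedness and the path connected basic neighbourhoods.
\<close>

lemma path_connectedin_minus_finite:
  assumes base: "punctured_connected_base X" and conn: "connected_space X" and t1: "t1_space X"
    and "finite S"
  shows "path_connectedin X (topspace X - S)"
proof -
  have op: "openin X (topspace X - T)" if "finite T" for T
  proof -
    have "closedin X (topspace X \<inter> T)"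
      using t1 that unfolding t1_space_closedin_finite by blast
    then have "openin X (topspace X - topspace X \<inter> T)" by blast
    moreover have "topspace X - topspace X \<inter> T = topspace X - T" by blast
    ultimately show ?thesis by simp
  qed
  have "connected_space (subtopology X (topspace X - S))"
    using \<open>finite S\<close>
  proof (induction S)
    case empty
    then show ?case using conn by simp
  next
    case (insert p S)
    let ?Y = "subtopology X (topspace X - S)"
    have eq: "topspace ?Y - {p} = topspace X - insert p S" by auto
    have sub: "subtopology X (topspace X - insert p S) = subtopology ?Y (topspace ?Y - {p})"
      unfolding eq subtopology_subtopology by (rule arg_cong[where f="subtopology X"]) auto
    show ?case
    proof (cases "p \<in> topspace ?Y")
      case False
      then have "topspace ?Y - {p} = topspace ?Y" by blast
      then show ?thesis unfolding sub using insert.IH by (metis subtopology_topspace)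
    next
      case True
      have "punctured_connected_base ?Y"
        by (rule punctured_connected_base_open_subset[OF base op[OF insert.hyps(1)]])
      then obtain W where "openin ?Y W" "p \<in> W" "connectedin ?Y (W - {p})"
        using True unfolding punctured_connected_base_def by (meson openin_topspace)
      then show ?thesis
        unfolding sub using insert.IH t1 by (intro connected_space_delete_point) (auto intro: t1_space_subtopology)
    qed
  qed
  moreover have "locally_path_connected_space X"
    using base unfolding locally_path_connected_space_def neighbourhood_base_of
      punctured_connected_base_def by (meson order_refl)
  ultimately show ?thesis
    using op[OF \<open>finite S\<close>] \<open>finite S\<close> unfolding path_connectedin_def
    by (auto simp: path_connected_eq_connected_space locally_path_connected_space_open_subset)
qed

text \<open>
  This provides the room for the intermediate configuration. A finite \<open>T\<^sub>1\<close> space is discrete, but a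
  basic neighbourhood inside \<open>{x}\<close> would have to be \<open>{x}\<close> itself.
\<close>

lemma infinite_topspace_punctured_connected_base:
  assumes base: "punctured_connected_base X" and t1: "t1_space X" and x: "x \<in> topspace X"
  shows "infinite (topspace X)"
proof
  assume fin: "finite (topspace X)"
  then have "closedin X (topspace X - {x})"
    using t1 unfolding t1_space_closedin_finite by (meson Diff_subset finite_Diff)
  then have "openin X {x}" using x by (simp add: closedin_def double_diff)
  then obtain W where "W \<subseteq> {x}" "x \<in> W" "W \<noteq> {x}"
    using base unfolding punctured_connected_base_def by (meson singletonI)
  then show False by auto
qed

section \<open>Fibres of the projection between configuration spaces\<close>

lemma topspace_config_space:
  "topspace (config_space M k) = {x \<in> {1..k} \<rightarrow>\<^sub>E topspace M. inj_on x {1..k}}"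
  by (auto simp: config_space_def inj_on_def)

lemma path_component_of_move_coordinate:
  assumes pc: "\<And>S. finite S \<Longrightarrow> path_connectedin M (topspace M - S)"
    and x: "x \<in> roots (config_space M k) (config_proj r) a"
    and i: "i \<in> {r<..k}"
    and p: "p \<in> topspace M" "p \<notin> x ` ({1..k} - {i})"
  shows "path_component_of (subtopology (config_space M k)
      (roots (config_space M k) (config_proj r) a)) x (x(i := p))"
proof -
  let ?S = "x ` ({1..k} - {i})"
  have xE: "x \<in> {1..k} \<rightarrow>\<^sub>E topspace M" and inj: "inj_on x {1..k}" and xa: "restrict x {1..r} = a"
    using x by (auto simp: roots_def topspace_config_space config_proj_def)
  have ik: "i \<in> {1..k}" using i by auto
  have "x i \<notin> ?S"
    using inj ik by (simp add: inj_on_image_mem_iff)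
  moreover have "x i \<in> topspace M"
    using xE ik by (rule PiE_mem)
  ultimately obtain g where g: "pathin M g" "g \<in> {0..1} \<rightarrow> topspace M - ?S" "g 0 = x i" "g 1 = p"
    using pc[of ?S] p unfolding path_connectedin by blast
  have in_power: "pathin (product_topology (\<lambda>_. M) {1..k}) (\<lambda>t. x(i := g t))"
    unfolding pathin_def continuous_map_componentwise
  proof (intro conjI ballI)
    show "(\<lambda>t. x(i := g t)) ` topspace (top_of_set {0..1}) \<subseteq> extensional {1..k}"
      using xE ik by (auto simp: extensional_def PiE_iff)
  next
    fix j assume "j \<in> {1..k}"
    then show "continuous_map (top_of_set {0..1}) M (\<lambda>t. (x(i := g t)) j)"
      using g(1) xE by (cases "j = i") (auto simp: pathin_def PiE_iff)
  qed
  have distinct: "(x(i := g t)) j \<noteq> (x(i := g t)) l"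
    if "t \<in> {0..1}" "j \<in> {1..k}" "l \<in> {1..k}" "j \<noteq> l" for t j l
  proof -
    have gt: "g t \<notin> ?S" using g(2) that(1) by blast
    have "x j \<noteq> x l" using inj that by (metis inj_onD)
    moreover have "x n \<in> ?S" if "n \<in> {1..k}" "n \<noteq> i" for n using that by blast
    ultimately show ?thesis using gt that by (metis fun_upd_apply)
  qed
  have in_config: "pathin (config_space M k) (\<lambda>t. x(i := g t))"
    unfolding config_space_def pathin_subtopology using in_power distinct by blast
  have "config_proj r (x(i := g t)) = a" for t
  proof -
    have "restrict (x(i := g t)) {1..r} = restrict x {1..r}"
      using i by (intro restrict_ext) auto
    then show ?thesis using xa by (simp add: config_proj_def)
  qed
  then have "pathin (subtopology (config_space M k)
      (roots (config_space M k) (config_proj r) a)) (\<lambda>t. x(i := g t))"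
    using in_config path_image_subset_topspace[OF in_config] by (auto simp: pathin_subtopology roots_def)
  then show ?thesis
    unfolding path_component_of_def using g by (intro exI[of _ "\<lambda>t. x(i := g t)"]) auto
qed

text \<open>
  The targets avoid all points of \<open>x\<close>, not only the fixed ones. Hence whichever free points have
  already been moved, the next target is unoccupied, and the induction can take the coordinates in
  any order.
\<close>

lemma path_component_of_move_all_free_coordinates:
  assumes pc: "\<And>S. finite S \<Longrightarrow> path_connectedin M (topspace M - S)"
    and x: "x \<in> roots (config_space M k) (config_proj r) a"
    and z: "z \<in> {r<..k} \<rightarrow> topspace M - x ` {1..k}" "inj_on z {r<..k}"
  shows "path_component_of (subtopology (config_space M k)
      (roots (config_space M k) (config_proj r) a)) x (override_on x z {r<..k})"
proof -
  let ?R = "roots (config_space M k) (config_proj r) a"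
  let ?F = "subtopology (config_space M k) ?R"
  have "path_component_of ?F x (override_on x z T)" if "finite T" "T \<subseteq> {r<..k}" for T
    using that
  proof (induction T)
    case empty
    then show ?case using x by (simp add: path_component_of_refl roots_def)
  next
    case (insert i T)
    let ?y = "override_on x z T"
    have IH: "path_component_of ?F x ?y" using insert by simp
    then have y: "?y \<in> ?R"
      by (metis IntD2 path_component_in_topspace topspace_subtopology)
    have i: "i \<in> {r<..k}" using insert by simp
    have "z i \<notin> ?y ` ({1..k} - {i})"
    proof
      assume "z i \<in> ?y ` ({1..k} - {i})"
      then obtain j where j: "j \<in> {1..k}" "j \<noteq> i" "z i = ?y j" by blast
      show False
      proof (cases "j \<in> T")
        case True
        then have "j \<in> {r<..k}" using insert.prems by auto
        with True j i z(2) show False by (simp add: inj_on_def)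
      next
        case False
        then have "z i \<in> x ` {1..k}" using j by simp
        then show False using funcset_mem[OF z(1) i] by blast
      qed
    qed
    moreover have "z i \<in> topspace M" using z(1) i by auto
    ultimately have "path_component_of ?F ?y (?y(i := z i))"
      using path_component_of_move_coordinate[OF pc y i] by blast
    moreover have "?y(i := z i) = override_on x z (insert i T)"
      by (rule override_on_insert[symmetric])
    ultimately show ?case using IH path_component_of_trans by metis
  qed
  then show ?thesis by blast
qed

text \<open>
  The intermediate configuration has to avoid \<open>x\<close> and \<open>y\<close> simultaneously. Once their free points
  sit at the common targets \<open>z\<close>, both have become the same configuration, since they already agreed
  on the first \<open>r\<close> points.
\<close>

lemma path_component_of_same_projection:
  assumes pc: "\<And>S. finite S \<Longrightarrow> path_connectedin M (topspace M - S)"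
    and inf: "infinite (topspace M)"
    and x: "x \<in> roots (config_space M k) (config_proj r) a"
    and y: "y \<in> roots (config_space M k) (config_proj r) a"
  shows "path_component_of (subtopology (config_space M k)
      (roots (config_space M k) (config_proj r) a)) x y"
proof -
  have "infinite (topspace M - (x ` {1..k} \<union> y ` {1..k}))" using inf by simp
  then obtain B where B: "finite B" "card B = card {r<..k}"
      "B \<subseteq> topspace M - (x ` {1..k} \<union> y ` {1..k})"
    by (meson infinite_arbitrarily_large)
  then obtain z where "bij_betw z {r<..k} B"
    by (metis finite_greaterThanAtMost finite_same_card_bij)
  then have z: "inj_on z {r<..k}" "z \<in> {r<..k} \<rightarrow> topspace M - x ` {1..k}"
      "z \<in> {r<..k} \<rightarrow> topspace M - y ` {1..k}"
    using B(3) by (auto simp: bij_betw_def)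
  have "override_on x z {r<..k} = override_on y z {r<..k}"
  proof
    fix j
    have "restrict x {1..r} j = restrict y {1..r} j" "x \<in> extensional {1..k}" "y \<in> extensional {1..k}"
      using x y by (auto simp: roots_def config_proj_def topspace_config_space PiE_def)
    then show "override_on x z {r<..k} j = override_on y z {r<..k} j"
      by (cases "j \<in> {1..r}") (auto simp: override_on_def extensional_def)
  qed
  moreover note path_component_of_move_all_free_coordinates[OF pc x z(2,1)]
    path_component_of_move_all_free_coordinates[OF pc y z(3,1), THEN path_component_of_sym]
  ultimately show ?thesis
    by (simp add: path_component_of_trans)
qed

section \<open>Root classes\<close>

lemma root_equiv_if_path_in_fibre:
  assumes a: "a \<in> topspace Y"
    and path: "path_component_of (subtopology X (roots X f a)) x y"
  shows "(x, y) \<in> root_equiv X Y f a"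
proof -
  obtain g where g: "pathin X g" "\<And>t. t \<in> {0..1} \<Longrightarrow> g t \<in> roots X f a" "g 0 = x" "g 1 = y"
    using path by (auto simp: path_component_of_def pathin_subtopology)
  have fg: "(f \<circ> g) t = a" if "t \<in> {0..1}" for t
    using g(2)[OF that] by (simp add: roots_def)
  \<comment> \<open>The loop agrees with a constant on the unit interval only, not as a function on the reals.\<close>
  have "continuous_map (top_of_set {0..1}) Y (f \<circ> g)"
    by (rule continuous_map_eq[where f="\<lambda>_. a"]) (use a fg in auto)
  then have "trivial_loop Y a (f \<circ> g)"
    unfolding trivial_loop_def using fg by (intro homotopic_with_equal) auto
  moreover have "x \<in> roots X f a" "y \<in> roots X f a"
    using g(2)[of 0] g(2)[of 1] g(3,4) by auto
  ultimately show ?thesis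
    using g by (auto simp: root_equiv_def)
qed

lemma nielsen_root_number_le_one:
  assumes "\<And>x y. x \<in> roots X f a \<Longrightarrow> y \<in> roots X f a \<Longrightarrow> (x, y) \<in> root_equiv X Y f a"
  shows "nielsen_root_number X Y f a \<le> 1"
proof -
  have "root_equiv X Y f a `` {x} = roots X f a" if "x \<in> roots X f a" for x
    using assms[OF that] by (auto simp: root_equiv_def)
  then have "root_classes X Y f a \<subseteq> {roots X f a}"
    by (auto simp: root_classes_def quotient_def)
  then have sub: "essential_root_classes X Y f a \<subseteq> {roots X f a}"
    by (auto simp: essential_root_classes_def)
  then have "finite (essential_root_classes X Y f a)" "card (essential_root_classes X Y f a) \<le> 1"
    using finite_subset card_mono[OF _ sub] by auto
  then show ?thesis
    by (simp add: nielsen_root_number_def one_enat_def)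
qed

theorem proposition3p9:
  fixes M :: "'a topology" and m k r :: nat and a :: "nat \<Rightarrow> 'a"
  assumes "topological_manifold m M" and "connected_space M" and "m \<ge> 2"
    and "k > r" and "r \<ge> 1"
    and "a \<in> topspace (config_space M r)"
  shows "nielsen_root_number (config_space M k) (config_space M r) (config_proj r) a \<le> 1"
proof -
  have base: "punctured_connected_base M"
    using assms by (intro punctured_connected_base_manifold)
  have t1: "t1_space M"
    using assms(1) by (simp add: topological_manifold_def Hausdorff_imp_t1_space)
  \<comment> \<open>As \<open>r \<ge> 1\<close>, the configuration \<open>a\<close> witnesses that \<open>M\<close> is nonempty, hence infinite.\<close>
  have "a 1 \<in> topspace M"
    using assms(5,6) by (auto simp: topspace_config_space PiE_iff)
  then have "infinite (topspace M)"
    using base t1 by (rule infinite_topspace_punctured_connected_base[rotated 2])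
  then show ?thesis
    using path_connectedin_minus_finite[OF base assms(2) t1] assms(6)
    by (intro nielsen_root_number_le_one root_equiv_if_path_in_fibre path_component_of_same_projection)
qed

end
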